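(* Let $n\ge 2$ and let $\mathbf{A}=[a_{ij}]$ be an $n\times n$ reciprocal pairwise comparison matrix with Koczkodaj's inconsistency index $KI(\mathbf{A})$, and put $\kappa = 1-KI(\mathbf{A})$. Let $w^{EV}$ and $w^{GM}$ be the normalized priority vectors of the $n$ compared objects obtained from $\mathbf{A}$ by the eigenvalue method and by the geometric mean method, respectively. Let the objects $O_1,\dots,O_n$ be numbered from the best ($O_1$) to the worst ($O_n$) according to the eigenvalue method, so that $w_1^{EV}\ge w_2^{EV}\ge\dots\ge w_n^{EV}$. Let $d=\min_{1\le i\le n-1}|w_{i+1}^{EV}-w_i^{EV}|$. If $$d>\frac{1}{\kappa^2}-1\ge MD(w^{EV},w^{GM}),$$ then the ordinal rankings of all objects obtained by the eigenvalue method and by the geometric mean method are identical.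
   Context: A pairwise comparison (PC) matrix of $n$ objects is an $n\times n$ real matrix $\mathbf{A}=[a_{ij}]$ with $a_{ij}>0$ and $a_{ii}=1$; it is reciprocal if $a_{ij}=1/a_{ji}$ for all $i,j$. All PC matrices are assumed reciprocal. Koczkodaj's inconsistency index is $$KI(\mathbf{A})=\max\left\{1-\min\left\{\frac{a_{ij}}{a_{ik}a_{kj}},\frac{a_{ik}a_{kj}}{a_{ij}}\right\} : i,j,k\in\{1,\dots,n\}\right\},$$ so $0\le KI(\mathbf{A})<1$. Eigenvalue (EV) method: $w^{EV}$ is the positive vector with $\mathbf{A}w^{EV}=\lambda_{\max}w^{EV}$, where $\lambda_{\max}$ is the largest (Perron–Frobenius) eigenvalue of $\mathbf{A}$, normalized so that $\sum_i w_i^{EV}=1$. Geometric mean (GM) method: $w_i^{GM}=\left(\prod_{k=1}^n a_{ik}\right)^{1/n}\Big/\sum_{j=1}^n\left(\prod_{k=1}^n a_{jk}\right)^{1/n}$, so $\sum_i w_i^{GM}=1$. $MD(u,v)=\sum_{i=1}^n|u_i-v_i|$ is the Manhattan distance. The ordinal ranking given by a priority vector $w$ orders objects by decreasing weight $w_i$. The rankings given by $w^{EV}$ and $w^{GM}$ are identical if for all $i,j$: $w_i^{EV}>w_j^{EV}$ if and only if $w_i^{GM}>w_j^{GM}$. *)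

theory Defs
  imports Complex_Main "Jordan_Normal_Form.Spectral_Radius"
begin

text \<open>The objects \<open>1, \<dots>, n\<close> are represented by the indices \<open>0, \<dots>, n - 1\<close>.\<close>

definition pc_matrix :: "nat \<Rightarrow> real mat \<Rightarrow> bool" where
  "pc_matrix n A \<longleftrightarrow> A \<in> carrier_mat n n
     \<and> (\<forall>i<n. \<forall>j<n. A $$ (i, j) > 0) \<and> (\<forall>i<n. A $$ (i, i) = 1)"

definition reciprocal :: "nat \<Rightarrow> real mat \<Rightarrow> bool" where
  "reciprocal n A \<longleftrightarrow> (\<forall>i<n. \<forall>j<n. A $$ (i, j) = 1 / A $$ (j, i))"

definition KI :: "nat \<Rightarrow> real mat \<Rightarrow> real" where
  "KI n A = Max {1 - min (A $$ (i, j) / (A $$ (i, k) * A $$ (k, j)))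
                         (A $$ (i, k) * A $$ (k, j) / A $$ (i, j))
                 | i j k. i < n \<and> j < n \<and> k < n}"

text \<open>The eigenvalues of a real matrix are complex in general; the Perron-Frobenius eigenvalue of
  a positive matrix is the largest of them in modulus, i.e. the spectral radius.\<close>

definition lambda_max :: "real mat \<Rightarrow> real" where
  "lambda_max A = spectral_radius (map_mat complex_of_real A)"

text \<open>By the Perron-Frobenius theorem exactly one vector satisfies the following predicate if
  \<open>A\<close> is a positive \<open>n \<times> n\<close> matrix with \<open>n \<ge> 1\<close>.\<close>

definition is_EV_vector :: "nat \<Rightarrow> real mat \<Rightarrow> real vec \<Rightarrow> bool" where
  "is_EV_vector n A w \<longleftrightarrow> w \<in> carrier_vec n \<and> (\<forall>i<n. w $ i > 0)
     \<and> A *\<^sub>v w = lambda_max A \<cdot>\<^sub>v w \<and> (\<Sum>i<n. w $ i) = 1"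

definition GM_vector :: "nat \<Rightarrow> real mat \<Rightarrow> real vec" where
  "GM_vector n A = vec n (\<lambda>i. root n (\<Prod>k<n. A $$ (i, k)) / (\<Sum>j<n. root n (\<Prod>k<n. A $$ (j, k))))"

definition MD :: "nat \<Rightarrow> real vec \<Rightarrow> real vec \<Rightarrow> real" where
  "MD n u v = (\<Sum>i<n. \<bar>u $ i - v $ i\<bar>)"

definition identical_rankings :: "nat \<Rightarrow> real vec \<Rightarrow> real vec \<Rightarrow> bool" where
  "identical_rankings n u v \<longleftrightarrow> (\<forall>i<n. \<forall>j<n. u $ i > u $ j \<longleftrightarrow> v $ i > v $ j)"

end

theory Submission imports Defs begin

text \<open>Passing from \<open>u\<close> to \<open>v\<close> changes the difference of the weights of two distinct objects by at
  most \<open>\<bar>u\<^sub>i - v\<^sub>i\<bar> + \<bar>u\<^sub>j - v\<^sub>j\<bar>\<close>. These are two different terms of the sum \<open>MD n u v\<close>, so the change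
  is at most \<open>MD n u v\<close> itself and not twice that number (\<open>difference_change_le_MD\<close>). If \<open>u\<close> is
  sorted and its consecutive weights are at least \<open>d\<close> apart, then any two of its weights are at
  least \<open>d\<close> apart (\<open>sorted_gap\<close>). Hence no pair of objects can change its order, or become tied,
  as long as \<open>MD n u v < d\<close> (\<open>identical_rankings_if_MD_less_gap\<close>).

  In the proposition the number \<open>1 / \<kappa>\<^sup>2 - 1\<close> separates \<open>MD\<close> from the smallest gap \<open>d\<close>.\<close>

text \<open>The triangle inequality bounds the change by the errors at \<open>i\<close> and \<open>j\<close>; as \<open>i \<noteq> j\<close>, these
  are two separate summands of \<open>MD n u v\<close>.\<close>

lemma difference_change_le_MD:
  assumes "i < n" and "j < n" and "i \<noteq> j"
  shows "\<bar>(u $ i - u $ j) - (v $ i - v $ j)\<bar> \<le> MD n u v"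
proof -
  have "\<bar>(u $ i - u $ j) - (v $ i - v $ j)\<bar> \<le> (\<Sum>k\<in>{i, j}. \<bar>u $ k - v $ k\<bar>)"
    using assms by simp
  also have "\<dots> \<le> MD n u v"
    unfolding MD_def using assms by (intro sum_mono2) auto
  finally show ?thesis .
qed

lemma sorted_gap:
  fixes u :: "real vec"
  assumes gap: "\<And>k. k + 1 < n \<Longrightarrow> u $ (k + 1) + d \<le> u $ k"
    and "0 \<le> d" and "i < j" and "j < n"
  shows "u $ j + d \<le> u $ i"
  using \<open>i < j\<close> \<open>j < n\<close>
proof (induction j)
  case (Suc j)
  show ?case
  proof (cases "i = j")
    case True
    then show ?thesis using gap[of j] Suc.prems by simp
  next
    case False
    then have "u $ j + d \<le> u $ i" using Suc by simp
    then show ?thesis using gap[of j] Suc.prems \<open>0 \<le> d\<close> by simp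
  qed
qed simp

lemma identical_rankings_if_MD_less_gap:
  assumes gap: "\<And>k. k + 1 < n \<Longrightarrow> u $ (k + 1) + d \<le> u $ k"
    and less: "MD n u v < d"
  shows "identical_rankings n u v"
proof -
  have "0 \<le> MD n u v"
    by (simp add: MD_def sum_nonneg)
  then have "0 \<le> d"
    using less by simp
  have order: "u $ i > u $ j \<and> v $ i > v $ j" if "i < j" "j < n" for i j
    using sorted_gap[OF gap \<open>0 \<le> d\<close> that] difference_change_le_MD[of i n j u v]
      \<open>0 \<le> MD n u v\<close> less that by auto
  show ?thesis
    unfolding identical_rankings_def by (metis order linorder_neqE_nat order_less_asym)
qed

theorem proposition1:
  fixes n :: nat and A :: "real mat" and wEV wGM :: "real vec" and \<kappa> d :: real
  assumes "n \<ge> 2"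
    and "pc_matrix n A" and "reciprocal n A"
    and "\<kappa> = 1 - KI n A"
    and "is_EV_vector n A wEV"
    and "wGM = GM_vector n A"
    and "\<forall>i. i + 1 < n \<longrightarrow> wEV $ i \<ge> wEV $ (i + 1)"
    and "d = Min {\<bar>wEV $ (i + 1) - wEV $ i\<bar> | i. i + 1 < n}"
    and "d > 1 / \<kappa>\<^sup>2 - 1"
    and "1 / \<kappa>\<^sup>2 - 1 \<ge> MD n wEV wGM"
  shows "identical_rankings n wEV wGM"
proof (rule identical_rankings_if_MD_less_gap)
  show "MD n wEV wGM < d"
    using assms(9,10) by simp
next
  fix k
  assume k: "k + 1 < n"
  have "finite {\<bar>wEV $ (i + 1) - wEV $ i\<bar> | i. i + 1 < n}"
    by (rule finite_image_set) (rule finite_subset[of _ "{..<n}"], auto)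
  then have "d \<le> \<bar>wEV $ (k + 1) - wEV $ k\<bar>"
    unfolding assms(8) using k by (intro Min_le) auto
  then show "wEV $ (k + 1) + d \<le> wEV $ k"
    using assms(7) k by fastforce
qed

end
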